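(* Let $G$ be an infinite countable discrete group that admits a right-invariant proper metric $\rho$ with symmetric horoballs space, and let $(X,T,G)$ be an infinite topological dynamical system such that $\mathrm{ND}_\varepsilon(X)$ is closed in $\partial G$ for every $\varepsilon>0$. Then $$\bigcap_{h\in\mathrm{ND}(X)}\{h<0\}\subseteq \mathrm{Tor}(G),$$ where $\mathrm{Tor}(G)$ is the set of torsion elements of $G$. In particular, if $G$ is torsion-free, the intersection $\bigcap_{h\in\mathrm{ND}(X)}\{h<0\}$ is empty.
   Context: A metric $\rho$ on $G$ is right-invariant if $\rho(gf,kf)=\rho(g,k)$ for all $g,k,f\in G$, and proper if every closed ball is finite. For $g\in G$ let $b_g\colon G\to\mathbb{R}$, $b_g(x)=\rho(g,x)-\rho(g,1_G)$. The border $\partial G$ is the set of functions $h\colon G\to\mathbb{R}$ for which there is a sequence $(g_n)$ in $G$ eventually leaving every finite subset of $G$ such that $b_{g_n}\to h$ pointwise; it carries the topology of pointwise convergence. Elements of $\partial G$ are called horofunctions, and the horoball of $h\in\partial G$ is $\{h<0\}=\{x\in G: h(x)<0\}$. $(G,\rho)$ has symmetric horoballs space if for any sequence $(g_n)$ in $G$ going to infinity such that both pointwise limits $h=\lim_n b_{g_n}$ and $h'=\lim_n b_{g_n^{-1}}$ exist, one has $\{g\in G: h(g^{-1})<0\}=\{g\in G: h'(g)<0\}$. A topological dynamical system $(X,T,G)$ is a compact metric space $(X,d)$ with a continuous action $T$ of $G$, written $T^g\colon X\to X$, with $T^{1_G}=\mathrm{id}_X$ and $T^{g}\circ T^{g'}=T^{gg'}$.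 It is infinite if $X$ is infinite. $\mathrm{ND}_\varepsilon(X)$ is the set of $h\in\partial G$ for which there are distinct $x,y\in X$ with $d(T^gx,T^gy)\le\varepsilon$ for all $g\in\{h<0\}$, and $\mathrm{ND}(X)=\bigcap_{\varepsilon>0}\mathrm{ND}_\varepsilon(X)$. The sets, horofunctions and horoballs are taken with respect to the metric $\rho$. *)

theory Defs
  imports "HOL-Analysis.Analysis" "HOL-Algebra.Multiplicative_Group" "HOL-Algebra.Group_Action"
begin

locale right_invariant_proper_metric = group G + Metric_space "carrier G" \<rho>
  for G :: "('a, 'm) monoid_scheme" (structure) and \<rho> :: "'a \<Rightarrow> 'a \<Rightarrow> real" +
  assumes right_invariant:
    "\<lbrakk>g \<in> carrier G; k \<in> carrier G; f \<in> carrier G\<rbrakk> \<Longrightarrow> \<rho> (g \<otimes> f) (k \<otimes> f) = \<rho> g k"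
    and proper: "g \<in> carrier G \<Longrightarrow> finite (mcball g r)"

definition goes_to_infinity :: "('a, 'm) monoid_scheme \<Rightarrow> (nat \<Rightarrow> 'a) \<Rightarrow> bool" where
  "goes_to_infinity G gs \<longleftrightarrow>
     (\<forall>n. gs n \<in> carrier G) \<and>
     (\<forall>F. finite F \<and> F \<subseteq> carrier G \<longrightarrow> (\<forall>\<^sub>F n in sequentially. gs n \<notin> F))"

definition busemann ::
  "('a, 'm) monoid_scheme \<Rightarrow> ('a \<Rightarrow> 'a \<Rightarrow> real) \<Rightarrow> 'a \<Rightarrow> 'a \<Rightarrow> real" where
  "busemann G \<rho> g x = \<rho> g x - \<rho> g \<one>\<^bsub>G\<^esub>"

definition converges_pointwise ::
  "('a, 'm) monoid_scheme \<Rightarrow> (nat \<Rightarrow> 'a \<Rightarrow> real) \<Rightarrow> ('a \<Rightarrow> real) \<Rightarrow> bool" where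
  "converges_pointwise G bs h \<longleftrightarrow> (\<forall>x\<in>carrier G. (\<lambda>n. bs n x) \<longlonglongrightarrow> h x)"

text \<open>Real functions on the group are represented by their extensional extensions, so that two
  horofunctions are equal as soon as they agree on the carrier.\<close>

definition border :: "('a, 'm) monoid_scheme \<Rightarrow> ('a \<Rightarrow> 'a \<Rightarrow> real) \<Rightarrow> ('a \<Rightarrow> real) set" where
  "border G \<rho> = {h \<in> extensional (carrier G).
     \<exists>gs. goes_to_infinity G gs \<and> converges_pointwise G (\<lambda>n. busemann G \<rho> (gs n)) h}"

definition border_topology ::
  "('a, 'm) monoid_scheme \<Rightarrow> ('a \<Rightarrow> 'a \<Rightarrow> real) \<Rightarrow> ('a \<Rightarrow> real) topology" where
  "border_topology G \<rho> = subtopology (powertop_real (carrier G)) (border G \<rho>)"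

definition horoball :: "('a, 'm) monoid_scheme \<Rightarrow> ('a \<Rightarrow> real) \<Rightarrow> 'a set" where
  "horoball G h = {x \<in> carrier G. h x < 0}"

definition symmetric_horoballs_space ::
  "('a, 'm) monoid_scheme \<Rightarrow> ('a \<Rightarrow> 'a \<Rightarrow> real) \<Rightarrow> bool" where
  "symmetric_horoballs_space G \<rho> \<longleftrightarrow>
     (\<forall>gs h h'. goes_to_infinity G gs
        \<and> converges_pointwise G (\<lambda>n. busemann G \<rho> (gs n)) h
        \<and> converges_pointwise G (\<lambda>n. busemann G \<rho> (inv\<^bsub>G\<^esub> (gs n))) h'
        \<longrightarrow> {g \<in> carrier G. h (inv\<^bsub>G\<^esub> g) < 0} = {g \<in> carrier G. h' g < 0})"

locale topological_dynamical_system = group_action G X T + Metric_space X d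
  for G :: "('a, 'm) monoid_scheme" (structure) and X :: "'x set" and d :: "'x \<Rightarrow> 'x \<Rightarrow> real" and T :: "'a \<Rightarrow> 'x \<Rightarrow> 'x" +
  assumes compact: "compact_space mtopology"
    and continuous_action:
      "continuous_map (prod_topology (discrete_topology (carrier G)) mtopology) mtopology
         (\<lambda>(g, x). T g x)"

definition ND_eps ::
  "('a, 'm) monoid_scheme \<Rightarrow> ('a \<Rightarrow> 'a \<Rightarrow> real) \<Rightarrow> 'x set \<Rightarrow> ('x \<Rightarrow> 'x \<Rightarrow> real) \<Rightarrow>
     ('a \<Rightarrow> 'x \<Rightarrow> 'x) \<Rightarrow> real \<Rightarrow> ('a \<Rightarrow> real) set" where
  "ND_eps G \<rho> X d T \<epsilon> = {h \<in> border G \<rho>.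
     \<exists>x\<in>X. \<exists>y\<in>X. x \<noteq> y \<and> (\<forall>g\<in>horoball G h. d (T g x) (T g y) \<le> \<epsilon>)}"

definition ND ::
  "('a, 'm) monoid_scheme \<Rightarrow> ('a \<Rightarrow> 'a \<Rightarrow> real) \<Rightarrow> 'x set \<Rightarrow> ('x \<Rightarrow> 'x \<Rightarrow> real) \<Rightarrow>
     ('a \<Rightarrow> 'x \<Rightarrow> 'x) \<Rightarrow> ('a \<Rightarrow> real) set" where
  "ND G \<rho> X d T = (\<Inter>\<epsilon>\<in>{0<..}. ND_eps G \<rho> X d T \<epsilon>)"

definition Tor :: "('a, 'm) monoid_scheme \<Rightarrow> 'a set" where
  "Tor G = {g \<in> carrier G. \<exists>n::nat. n > 0 \<and> g [^]\<^bsub>G\<^esub> n = \<one>\<^bsub>G\<^esub>}"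

definition torsion_free :: "('a, 'm) monoid_scheme \<Rightarrow> bool" where
  "torsion_free G \<longleftrightarrow> Tor G = {\<one>\<^bsub>G\<^esub>}"

end

theory Submission
  imports Defs "HOL-Complex_Analysis.Great_Picard"
begin

text \<open>Write \<open>|k| = \<rho>(k, 1)\<close>, and suppose that \<open>h(g) < 0\<close> for all \<open>h\<close> in \<open>ND(X)\<close> although \<open>g\<close> has
  infinite order. Compactness of the border gives an \<open>\<epsilon>\<close> such that already \<open>h(g) < 0\<close> on
  \<open>ND\<^sub>\<epsilon>(X)\<close>. Some horofunction is nonnegative at \<open>g\<close>, so no two distinct points are
  \<open>\<epsilon>\<close>-close along all of \<open>G\<close>; and if a pair of points first fails to be \<open>\<epsilon>\<close>-close at \<open>k\<close> with
  \<open>|k| > N\<close>, then \<open>|k g| < |k|\<close>. Let \<open>R n\<close> be the length of the first failure of the pair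
  translated by \<open>g\<^sup>-\<^sup>n\<close>. Then \<open>R n > N\<close> implies \<open>R (n+1) < R n\<close>, and \<open>R (n+1) > N + |g|\<close> implies
  \<open>R n > N\<close>, hence \<open>R n > N + |g|\<close>. Since \<open>X\<close> is infinite, the pigeonhole principle yields a pair
  with \<open>R n > N + |g|\<close> for infinitely many \<open>n\<close>, hence for all \<open>n\<close>, so that \<open>R\<close> decreases forever,
  which properness forbids. This is the argument that a compact space with a positively expansive
  homeomorphism is finite, with horoballs in place of half-lines.\<close>

section \<open>Right-invariant proper metrics and their border\<close>

context right_invariant_proper_metric
begin

section \<open>Length function of a right-invariant proper metric\<close>

definition len :: "'a \<Rightarrow> real" where
  "len k = \<rho> k \<one>"

lemma dist_eq_len:
  assumes "g \<in> carrier G" "k \<in> carrier G"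
  shows "\<rho> g k = len (g \<otimes> inv k)"
  using right_invariant[of g k "inv k"] assms by (simp add: len_def)

lemma len_inv: "k \<in> carrier G \<Longrightarrow> len (inv k) = len k"
  using right_invariant[of "inv k" \<one> k] commute[of \<one> k] by (simp add: len_def)

lemma len_mult_le:
  assumes "k \<in> carrier G" "g \<in> carrier G"
  shows "len (k \<otimes> g) \<le> len k + len g"
  using triangle[of "k \<otimes> g" g \<one>] right_invariant[of k \<one> g] assms by (simp add: len_def)

lemma finite_len_le: "finite {k \<in> carrier G. len k \<le> r}"
proof (rule finite_subset)
  show "{k \<in> carrier G. len k \<le> r} \<subseteq> mcball \<one> r"
    by (auto simp: len_def commute)
qed (simp add: proper)

lemma busemann_eq_len:
  assumes "g \<in> carrier G" "x \<in> carrier G"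
  shows "busemann G \<rho> g x = len (g \<otimes> inv x) - len g"
  using assms by (simp add: busemann_def dist_eq_len)

lemma abs_busemann_le:
  assumes "g \<in> carrier G" "x \<in> carrier G"
  shows "\<bar>busemann G \<rho> g x\<bar> \<le> len x"
  using triangle[of g x \<one>] triangle[of g \<one> x] commute[of \<one> x] assms
  by (simp add: busemann_def len_def abs_le_iff)

text \<open>By properness every finite set lies in a ball and every ball is finite. Since
  \<open>len\<close> is invariant under inversion, this form makes it evident that inverses also go
  to infinity.\<close>

lemma goes_to_infinity_iff_len:
  "goes_to_infinity G gs \<longleftrightarrow>
     (\<forall>n. gs n \<in> carrier G) \<and> filterlim (\<lambda>n. len (gs n)) at_top sequentially"
proof (intro iffI conjI)
  assume L: "goes_to_infinity G gs"
  then show "\<forall>n. gs n \<in> carrier G"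
    by (simp add: goes_to_infinity_def)
  show "filterlim (\<lambda>n. len (gs n)) at_top sequentially"
    unfolding filterlim_at_top
  proof
    fix Z
    have "\<forall>\<^sub>F n in sequentially. gs n \<notin> {k \<in> carrier G. len k \<le> Z}"
      using L finite_len_le[of Z] unfolding goes_to_infinity_def by blast
    then show "\<forall>\<^sub>F n in sequentially. Z \<le> len (gs n)"
      by eventually_elim (use L in \<open>auto simp: goes_to_infinity_def\<close>)
  qed
next
  assume R: "(\<forall>n. gs n \<in> carrier G) \<and> filterlim (\<lambda>n. len (gs n)) at_top sequentially"
  have "\<forall>\<^sub>F n in sequentially. gs n \<notin> F" if "finite F" "F \<subseteq> carrier G" for F
  proof -
    \<comment> \<open>The inserted 0 keeps the maximum meaningful when \<open>F\<close> is
      empty.\<close>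
    have "\<forall>\<^sub>F n in sequentially. Max (insert 0 (len ` F)) < len (gs n)"
      using R by (simp add: filterlim_at_top_dense del: Max_less_iff)
    then show ?thesis
      by eventually_elim (use that in auto)
  qed
  with R show "goes_to_infinity G gs"
    by (simp add: goes_to_infinity_def)
qed

lemma inj_goes_to_infinity:
  assumes "inj gs" "\<And>n. gs n \<in> carrier G"
  shows "goes_to_infinity G gs"
  unfolding goes_to_infinity_def
proof (intro conjI allI impI)
  fix F assume "finite F \<and> F \<subseteq> carrier G"
  then have "finite {n. gs n \<in> F}"
    using finite_vimageI[of F gs] assms(1) by (simp add: vimage_def)
  then show "\<forall>\<^sub>F n in sequentially. gs n \<notin> F"
    by (simp add: cofinite_eq_sequentially[symmetric] eventually_cofinite)
qed (use assms in auto)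

lemma goes_to_infinity_subseq:
  assumes "goes_to_infinity G gs" "strict_mono r"
  shows "goes_to_infinity G (\<lambda>n. gs (r n))"
  using assms by (auto simp: goes_to_infinity_def intro: eventually_subseq)

lemma goes_to_infinity_inv:
  assumes "goes_to_infinity G gs"
  shows "goes_to_infinity G (\<lambda>n. inv (gs n))"
  using assms by (simp add: goes_to_infinity_iff_len len_inv)

section \<open>Sequential compactness of the border\<close>

lemma countable_carrier: "countable (carrier G)"
proof -
  have "carrier G = (\<Union>n::nat. {k \<in> carrier G. len k \<le> real n})"
    by (simp add: set_eq_iff real_arch_simple)
  moreover have "countable (\<Union>n::nat. {k \<in> carrier G. len k \<le> real n})"
    by (rule countable_UN) (auto intro: countable_finite finite_len_le)
  ultimately show ?thesis by simp
qed

text \<open>Diagonal extraction over the countable group asks for a uniform bound, so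
  \<open>f n x\<close> is first divided by \<open>1 + len x\<close> and the limits are multiplied
  back. The summand 1 is there because \<open>len\<close> vanishes at the identity.\<close>

lemma pointwise_subsequence:
  fixes f :: "nat \<Rightarrow> 'a \<Rightarrow> real"
  assumes "\<And>n x. x \<in> carrier G \<Longrightarrow> \<bar>f n x\<bar> \<le> len x"
  obtains r h where "strict_mono (r :: nat \<Rightarrow> nat)" "h \<in> extensional (carrier G)"
    "converges_pointwise G (\<lambda>n. f (r n)) h"
proof -
  have pos: "1 + len x > 0" if "x \<in> carrier G" for x
    by (simp add: len_def add_pos_nonneg)
  have bd: "norm (f n x / (1 + len x)) \<le> 1" if "x \<in> carrier G" for n x
    using assms[OF that, of n] pos[OF that] by (simp add: divide_simps)
  obtain r where r: "strict_mono (r :: nat \<Rightarrow> nat)"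
      "\<And>x. x \<in> carrier G \<Longrightarrow> \<exists>l. (\<lambda>n. f (r n) x / (1 + len x)) \<longlonglongrightarrow> l"
    using function_convergent_subsequence[OF countable_carrier,
        of "\<lambda>n x. f n x / (1 + len x)" 1] bd by blast
  have "\<exists>l. (\<lambda>n. f (r n) x) \<longlonglongrightarrow> l" if x: "x \<in> carrier G" for x
  proof -
    obtain l where "(\<lambda>n. f (r n) x / (1 + len x)) \<longlonglongrightarrow> l"
      using r(2)[OF x] by blast
    from tendsto_mult_right[OF this, of "1 + len x"] pos[OF x] show ?thesis
      by auto
  qed
  then obtain h where h: "\<And>x. x \<in> carrier G \<Longrightarrow> (\<lambda>n. f (r n) x) \<longlonglongrightarrow> h x"
    by metis
  show thesis
    \<comment> \<open>The border consists of extensional functions, so the limit is made undefined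
      off the carrier.\<close>
    by (rule that[of r "restrict h (carrier G)"])
      (use r h in \<open>auto simp: converges_pointwise_def\<close>)
qed

lemma busemann_subsequence:
  assumes "goes_to_infinity G gs"
  obtains r h where "strict_mono (r :: nat \<Rightarrow> nat)" "h \<in> border G \<rho>"
    "converges_pointwise G (\<lambda>n. busemann G \<rho> (gs (r n))) h"
proof -
  have gs: "gs n \<in> carrier G" for n
    using assms by (simp add: goes_to_infinity_def)
  obtain r h where r: "strict_mono (r :: nat \<Rightarrow> nat)" "h \<in> extensional (carrier G)"
    "converges_pointwise G (\<lambda>n. busemann G \<rho> (gs (r n))) h"
    using pointwise_subsequence[of "\<lambda>n. busemann G \<rho> (gs n)"] abs_busemann_le gs by blast
  then show thesis
    using that goes_to_infinity_subseq[OF assms r(1)] unfolding border_def by blast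
qed

lemma border_abs_le:
  assumes "h \<in> border G \<rho>" "x \<in> carrier G"
  shows "\<bar>h x\<bar> \<le> len x"
proof -
  obtain gs where gs: "goes_to_infinity G gs"
      "converges_pointwise G (\<lambda>n. busemann G \<rho> (gs n)) h"
    using assms(1) by (auto simp: border_def)
  then have "(\<lambda>n. \<bar>busemann G \<rho> (gs n) x\<bar>) \<longlonglongrightarrow> \<bar>h x\<bar>"
    using assms(2) by (auto simp: converges_pointwise_def intro: tendsto_rabs)
  then show ?thesis
    using abs_busemann_le gs(1) assms(2)
    by (intro LIMSEQ_le_const2) (auto simp: goes_to_infinity_def)
qed

text \<open>Balls are finite, so pointwise convergence is uniform on each of them, and a sequence to
  infinity can be traded for single far elements. With this form, closedness of the border is a
  \<delta>/2 estimate instead of a diagonal choice of sequences.\<close>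

lemma border_iff_approx:
  "h \<in> border G \<rho> \<longleftrightarrow> h \<in> extensional (carrier G) \<and>
     (\<forall>r \<delta>. \<delta> > 0 \<longrightarrow> (\<exists>g\<in>carrier G. len g > r \<and>
        (\<forall>x\<in>carrier G. len x \<le> r \<longrightarrow> \<bar>busemann G \<rho> g x - h x\<bar> < \<delta>)))"
    (is "_ \<longleftrightarrow> _ \<and> ?approx")
proof (intro iffI conjI)
  assume L: "h \<in> border G \<rho>"
  then show "h \<in> extensional (carrier G)"
    by (simp add: border_def)
  obtain gs where gs: "goes_to_infinity G gs"
      "converges_pointwise G (\<lambda>n. busemann G \<rho> (gs n)) h"
    using L by (auto simp: border_def)
  show ?approx
  proof (intro allI impI)
    fix r \<delta> :: real assume "\<delta> > 0"
    have "\<forall>\<^sub>F n in sequentially. \<forall>x\<in>{k \<in> carrier G. len k \<le> r}.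
        dist (busemann G \<rho> (gs n) x) (h x) < \<delta>"
      using gs(2) \<open>\<delta> > 0\<close>
      by (intro eventually_ball_finite finite_len_le) (auto simp: converges_pointwise_def tendsto_iff)
    moreover have "\<forall>\<^sub>F n in sequentially. r < len (gs n)"
      using gs(1) by (simp add: goes_to_infinity_iff_len filterlim_at_top_dense)
    ultimately have "\<forall>\<^sub>F n in sequentially. r < len (gs n) \<and>
        (\<forall>x\<in>{k \<in> carrier G. len k \<le> r}. dist (busemann G \<rho> (gs n) x) (h x) < \<delta>)"
      by eventually_elim simp
    then obtain n where "r < len (gs n)"
        "\<forall>x\<in>{k \<in> carrier G. len k \<le> r}. dist (busemann G \<rho> (gs n) x) (h x) < \<delta>"
      by (metis (no_types, lifting) eventually_happens' sequentially_bot)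
    then show "\<exists>g\<in>carrier G. len g > r \<and>
        (\<forall>x\<in>carrier G. len x \<le> r \<longrightarrow> \<bar>busemann G \<rho> g x - h x\<bar> < \<delta>)"
      using gs(1) by (intro bexI[of _ "gs n"]) (auto simp: goes_to_infinity_def dist_real_def)
  qed
next
  assume R: "h \<in> extensional (carrier G) \<and> ?approx"
  have "\<exists>g. g \<in> carrier G \<and> len g > real n \<and>
      (\<forall>x\<in>carrier G. len x \<le> real n \<longrightarrow> \<bar>busemann G \<rho> g x - h x\<bar> < 1 / real (Suc n))" for n
    using R by (metis of_nat_0_less_iff zero_less_Suc zero_less_divide_1_iff)
  then obtain gs where gs: "\<And>n. gs n \<in> carrier G" "\<And>n. len (gs n) > real n"
      "\<And>n x. \<lbrakk>x \<in> carrier G; len x \<le> real n\<rbrakk> \<Longrightarrow>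
         \<bar>busemann G \<rho> (gs n) x - h x\<bar> < 1 / real (Suc n)"
    by metis
  have "goes_to_infinity G gs"
    unfolding goes_to_infinity_iff_len
    using gs(1) less_imp_le[OF gs(2)]
    by (auto intro: filterlim_at_top_mono[OF filterlim_real_sequentially])
  moreover have "(\<lambda>n. busemann G \<rho> (gs n) x) \<longlonglongrightarrow> h x" if x: "x \<in> carrier G" for x
  proof (rule LIM_zero_cancel, rule Lim_null_comparison)
    show "\<forall>\<^sub>F n in sequentially. norm (busemann G \<rho> (gs n) x - h x) \<le> 1 / real (Suc n)"
      using eventually_ge_at_top[of "nat \<lceil>len x\<rceil>"]
    proof eventually_elim
      case (elim n)
      then have "len x \<le> real n" by linarith
      from gs(3)[OF x this] show ?case by simp
    qed
    show "(\<lambda>n. 1 / real (Suc n)) \<longlonglongrightarrow> 0"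
      using LIMSEQ_inverse_real_of_nat by (simp add: inverse_eq_divide)
  qed
  ultimately show "h \<in> border G \<rho>"
    using R unfolding border_def converges_pointwise_def by blast
qed

lemma border_pointwise_limit:
  assumes "\<And>n. hs n \<in> border G \<rho>" "h \<in> extensional (carrier G)" "converges_pointwise G hs h"
  shows "h \<in> border G \<rho>"
  unfolding border_iff_approx
proof (intro conjI allI impI)
  fix r \<delta> :: real assume "\<delta> > 0"
  have "\<forall>x\<in>{k \<in> carrier G. len k \<le> r}. \<forall>\<^sub>F n in sequentially. dist (hs n x) (h x) < \<delta> / 2"
    using assms(3) tendstoD[OF _ half_gt_zero[OF \<open>\<delta> > 0\<close>]]
    unfolding converges_pointwise_def by blast
  then have "\<forall>\<^sub>F n in sequentially. \<forall>x\<in>{k \<in> carrier G. len k \<le> r}. dist (hs n x) (h x) < \<delta> / 2"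
    by (intro eventually_ball_finite finite_len_le)
  then obtain n where n: "\<forall>x\<in>{k \<in> carrier G. len k \<le> r}. dist (hs n x) (h x) < \<delta> / 2"
    by (metis (no_types, lifting) eventually_happens' sequentially_bot)
  obtain g where g: "g \<in> carrier G" "len g > r"
      "\<And>x. \<lbrakk>x \<in> carrier G; len x \<le> r\<rbrakk> \<Longrightarrow> \<bar>busemann G \<rho> g x - hs n x\<bar> < \<delta> / 2"
    using assms(1)[of n] \<open>\<delta> > 0\<close> unfolding border_iff_approx by (meson half_gt_zero)
  have "\<bar>busemann G \<rho> g x - h x\<bar> < \<delta>" if "x \<in> carrier G" "len x \<le> r" for x
  proof -
    have "\<bar>hs n x - h x\<bar> < \<delta> / 2"
      using n that by (auto simp: dist_real_def)
    with g(3)[OF that] show ?thesis by linarith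
  qed
  with g show "\<exists>g\<in>carrier G. len g > r \<and>
        (\<forall>x\<in>carrier G. len x \<le> r \<longrightarrow> \<bar>busemann G \<rho> g x - h x\<bar> < \<delta>)"
    by blast
qed (use assms in auto)

lemma border_subsequence:
  assumes "\<And>n. hs n \<in> border G \<rho>"
  obtains r h where "strict_mono (r :: nat \<Rightarrow> nat)" "h \<in> border G \<rho>"
    "converges_pointwise G (\<lambda>n. hs (r n)) h"
proof -
  obtain r h where r: "strict_mono (r :: nat \<Rightarrow> nat)" "h \<in> extensional (carrier G)"
      "converges_pointwise G (\<lambda>n. hs (r n)) h"
    by (rule pointwise_subsequence[of hs]) (rule border_abs_le[OF assms])
  moreover have "h \<in> border G \<rho>"
    by (rule border_pointwise_limit[OF _ r(2,3)]) (rule assms)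
  ultimately show thesis
    using that by blast
qed

lemma closedin_border_limit:
  assumes "closedin (border_topology G \<rho>) S" "\<forall>\<^sub>F n in sequentially. hs n \<in> S"
    and "\<And>n. hs n \<in> border G \<rho>" "h \<in> border G \<rho>" "converges_pointwise G hs h"
  shows "h \<in> S"
proof (rule limitin_closedin)
  show "limitin (border_topology G \<rho>) hs h sequentially"
    using assms(3-5)
    by (auto simp: border_topology_def limitin_subtopology limitin_componentwise
        border_def PiE_def converges_pointwise_def)
qed (use assms in auto)

section \<open>Descent of lengths and elements of infinite order\<close>

lemma len_not_eventually_decreasing:
  assumes "\<And>n. f n \<in> carrier G"
  shows "\<exists>n\<ge>(M::nat). len (f n) \<le> len (f (Suc n))"
proof (rule ccontr)
  assume "\<not> ?thesis"
  then have dec: "len (f (Suc n)) < len (f n)" if "n \<ge> M" for n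
    using that by (meson not_le)
  define q where "q n = len (f (M + n))" for n
  have mono: "strict_mono (\<lambda>n. - q n)"
    using dec by (intro strict_monoI_Suc) (simp add: q_def)
  then have "inj q"
    by (simp add: inj_def strict_mono_eq[OF mono, simplified])
  moreover have "q n \<le> q 0" for n
    using monoD[OF strict_mono_mono[OF mono], of 0 n] by simp
  \<comment> \<open>A decreasing sequence of lengths takes its values on one ball, which properness
    makes finite.\<close>
  then have "range q \<subseteq> len ` {k \<in> carrier G. len k \<le> q 0}"
    using assms by (auto simp: q_def)
  then have "finite (range q)"
    by (rule finite_subset) (simp add: finite_len_le)
  ultimately show False
    using finite_imageD infinite_UNIV_nat by blast
qed

lemma inj_nat_pow_infinite_order:
  assumes g: "g \<in> carrier G" and "g \<notin> Tor G"
  shows "inj (\<lambda>n::nat. g [^] n)"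
proof (rule linorder_injI)
  fix m n :: nat assume "m < n"
  show "g [^] m \<noteq> g [^] n"
  proof
    assume "g [^] m = g [^] n"
    then have "g [^] (n - m) = \<one>"
      using pow_eq_div2[of g n m] g by simp
    moreover have "n - m > 0"
      using \<open>m < n\<close> by simp
    ultimately show False
      using assms unfolding Tor_def by blast
  qed
qed

lemma inv_mem_Tor_iff:
  assumes "g \<in> carrier G"
  shows "inv g \<in> Tor G \<longleftrightarrow> g \<in> Tor G"
  using assms by (auto simp: Tor_def nat_pow_inv inv_eq_1_iff)

text \<open>With \<open>p n = g^-n\<close>, the function \<open>b_(p n)\<close> has at
  \<open>g\<close> the value \<open>|p (n+1)| - |p n|\<close>. Lengths cannot decrease forever, so
  this is nonnegative for infinitely many \<open>n\<close>; the powers are distinct and go to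
  infinity, and a limit along these \<open>n\<close> is the desired horofunction.\<close>

lemma infinite_order_nonneg_horofunction:
  assumes g: "g \<in> carrier G" and "g \<notin> Tor G"
  obtains h where "h \<in> border G \<rho>" "h g \<ge> 0"
proof -
  define p where "p n = inv g [^] (n::nat)" for n
  have p: "p n \<in> carrier G" for n
    using g by (simp add: p_def)
  have "inj p"
    using inj_nat_pow_infinite_order[of "inv g"] assms
    by (simp add: p_def[abs_def] inv_mem_Tor_iff)
  define I where "I = {n. len (p n) \<le> len (p (Suc n))}"
  have I: "infinite I"
    using len_not_eventually_decreasing[of p, OF p] by (simp add: I_def infinite_nat_iff_unbounded_le)
  have "goes_to_infinity G (\<lambda>n. p (enumerate I n))"
    using goes_to_infinity_subseq[OF inj_goes_to_infinity[OF \<open>inj p\<close> p] strict_mono_enumerate[OF I]] .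
  then obtain r h where h: "h \<in> border G \<rho>"
      "converges_pointwise G (\<lambda>n. busemann G \<rho> (p (enumerate I (r n)))) h"
    using busemann_subsequence by blast
  have "busemann G \<rho> (p (enumerate I n)) g \<ge> 0" for n
    using enumerate_in_set[OF I, of n] g p by (simp add: busemann_eq_len I_def p_def)
  then have "h g \<ge> 0"
    using h(2) g
    by (intro LIMSEQ_le_const[of "\<lambda>n. busemann G \<rho> (p (enumerate I (r n))) g"])
      (auto simp: converges_pointwise_def)
  with h(1) show thesis by (rule that)
qed

end

section \<open>Pairs of points that stay close on horoballs\<close>

context topological_dynamical_system
begin

lemma pair_subsequence:
  assumes "range a \<subseteq> X" "range b \<subseteq> X"
  obtains r x y where "strict_mono (r :: nat \<Rightarrow> nat)" "x \<in> X" "y \<in> X"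
    "limitin mtopology (a \<circ> r) x sequentially" "limitin mtopology (b \<circ> r) y sequentially"
proof -
  obtain r x where r: "strict_mono (r :: nat \<Rightarrow> nat)" "x \<in> X"
      "limitin mtopology (a \<circ> r) x sequentially"
    using assms(1) compact unfolding compact_space_sequentially by blast
  have "range (b \<circ> r) \<subseteq> X"
    using assms(2) by auto
  then obtain s y where s: "strict_mono (s :: nat \<Rightarrow> nat)" "y \<in> X"
      "limitin mtopology ((b \<circ> r) \<circ> s) y sequentially"
    using compact unfolding compact_space_sequentially by blast
  show thesis
    by (rule that[of "r \<circ> s" x y])
      (use r s limitin_subsequence[OF s(1) r(3)] in \<open>auto simp: strict_mono_o o_assoc\<close>)
qed

lemma tendsto_dist:
  assumes "range a \<subseteq> X" "range b \<subseteq> X"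
    and a: "limitin mtopology a x sequentially" and b: "limitin mtopology b y sequentially"
  shows "(\<lambda>n. d (a n) (b n)) \<longlonglongrightarrow> d x y"
proof (rule LIM_zero_cancel, rule Lim_null_comparison)
  have xy: "x \<in> X" "y \<in> X"
    using a b limitin_mspace by blast+
  show "\<forall>\<^sub>F n in sequentially. norm (d (a n) (b n) - d x y) \<le> d (a n) x + d (b n) y"
  proof (intro always_eventually allI)
    fix n
    have ab: "a n \<in> X" "b n \<in> X"
      using assms by auto
    show "norm (d (a n) (b n) - d x y) \<le> d (a n) x + d (b n) y"
      using triangle[of "a n" x "b n"] triangle[of x y "b n"] triangle[of x "a n" y]
        triangle[of "a n" "b n" y] commute[of x "a n"] commute[of y "b n"] ab xy
      by (simp add: abs_le_iff)
  qed
  have "(\<lambda>n. d (a n) x) \<longlonglongrightarrow> 0" "(\<lambda>n. d (b n) y) \<longlonglongrightarrow> 0"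
    using a b limitin_metric_dist_null by blast+
  then show "(\<lambda>n. d (a n) x + d (b n) y) \<longlonglongrightarrow> 0"
    using tendsto_add_zero by blast
qed

lemma continuous_T:
  assumes "g \<in> carrier G"
  shows "continuous_map mtopology mtopology (T g)"
proof -
  have "continuous_map mtopology (prod_topology (discrete_topology (carrier G)) mtopology) (\<lambda>x. (g, x))"
    using assms by (simp add: continuous_map_pairwise o_def)
  from continuous_map_compose[OF this continuous_action] show ?thesis
    by (simp add: o_def)
qed

lemma T_closed: "\<lbrakk>g \<in> carrier G; x \<in> X\<rbrakk> \<Longrightarrow> T g x \<in> X"
  using element_image by blast

lemma tendsto_dist_T:
  assumes g: "g \<in> carrier G" and "range a \<subseteq> X" "range b \<subseteq> X"
    and "limitin mtopology a x sequentially" "limitin mtopology b y sequentially"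
  shows "(\<lambda>n. d (T g (a n)) (T g (b n))) \<longlonglongrightarrow> d (T g x) (T g y)"
  by (rule tendsto_dist)
    (use assms T_closed continuous_map_limit[OF continuous_T[OF g]] in \<open>auto simp: o_def\<close>)

lemma uniformly_close_T:
  assumes u: "u \<in> carrier G" and "\<epsilon> > 0"
  shows "\<exists>\<delta>>0. \<forall>x\<in>X. \<forall>y\<in>X. d x y < \<delta> \<longrightarrow> d (T u x) (T u y) \<le> \<epsilon>"
proof (rule ccontr)
  assume *: "\<not> ?thesis"
  then have "\<exists>x y. x \<in> X \<and> y \<in> X \<and> d x y < \<delta> \<and> d (T u x) (T u y) > \<epsilon>" if "\<delta> > 0" for \<delta>
    using * that by (meson not_le)
  then have "\<exists>x y. x \<in> X \<and> y \<in> X \<and> d x y < inverse (real (Suc n)) \<and> d (T u x) (T u y) > \<epsilon>" for n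
    by simp
  then obtain a b where ab: "\<And>n. a n \<in> X" "\<And>n. b n \<in> X"
      "\<And>n. d (a n) (b n) < inverse (real (Suc n))" "\<And>n. d (T u (a n)) (T u (b n)) > \<epsilon>"
    by metis
  then have ran: "range a \<subseteq> X" "range b \<subseteq> X"
    by auto
  then obtain r x y where r: "strict_mono (r :: nat \<Rightarrow> nat)" "x \<in> X" "y \<in> X"
      "limitin mtopology (a \<circ> r) x sequentially" "limitin mtopology (b \<circ> r) y sequentially"
    by (rule pair_subsequence)
  have ran': "range (a \<circ> r) \<subseteq> X" "range (b \<circ> r) \<subseteq> X"
    using ab by auto
  have "(\<lambda>n. d (a n) (b n)) \<longlonglongrightarrow> 0"
    by (rule tendsto_sandwich[OF _ _ tendsto_const LIMSEQ_inverse_real_of_nat])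
      (use ab in \<open>auto intro!: always_eventually less_imp_le\<close>)
  then have "(\<lambda>n. d ((a \<circ> r) n) ((b \<circ> r) n)) \<longlonglongrightarrow> 0"
    using LIMSEQ_subseq_LIMSEQ[OF _ r(1)] by (simp add: o_def)
  with tendsto_dist[OF ran' r(4,5)] have "d x y = 0"
    using LIMSEQ_unique by blast
  then have "x = y"
    using r by simp
  moreover have "\<epsilon> \<le> d (T u x) (T u y)"
    by (rule LIMSEQ_le_const[OF tendsto_dist_T[OF u ran' r(4,5)]])
      (use ab(4) in \<open>auto intro: less_imp_le\<close>)
  ultimately show False
    using \<open>\<epsilon> > 0\<close> r u T_closed by simp
qed

text \<open>Two pigeonholes. Choose \<delta> for the finite set \<open>F\<close> by uniform
  continuity, cover \<open>X\<close> by balls of radius \<delta>/2, and take one more point than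
  there are balls: for each \<open>n\<close>, two of the points are sent by \<open>p n\<close> into
  one ball. There are finitely many pairs, so one of them serves infinitely many
  \<open>n\<close>.\<close>

lemma infinitely_often_close_pair:
  assumes "infinite X" "finite F" "F \<subseteq> carrier G" "\<epsilon> > 0" and p: "\<And>n::nat. p n \<in> carrier G"
  obtains x y where "x \<in> X" "y \<in> X" "x \<noteq> y"
    "infinite {n. \<forall>u\<in>F. d (T (u \<otimes> p n) x) (T (u \<otimes> p n) y) \<le> \<epsilon>}"
proof -
  have "\<exists>\<delta>>0. \<forall>u\<in>F. \<forall>x\<in>X. \<forall>y\<in>X. d x y < \<delta> \<longrightarrow> d (T u x) (T u y) \<le> \<epsilon>"
    using assms(2,3)
  proof (induction F rule: finite_induct)
    case (insert u F)
    then obtain \<delta> where \<delta>: "\<delta> > 0" "\<forall>u\<in>F. \<forall>x\<in>X. \<forall>y\<in>X. d x y < \<delta> \<longrightarrow> d (T u x) (T u y) \<le> \<epsilon>"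
      by auto
    obtain \<delta>' where \<delta>': "\<delta>' > 0" "\<And>x y. \<lbrakk>x \<in> X; y \<in> X; d x y < \<delta>'\<rbrakk> \<Longrightarrow> d (T u x) (T u y) \<le> \<epsilon>"
      using uniformly_close_T insert.prems \<open>\<epsilon> > 0\<close> by (meson insert_subset)
    show ?case
      by (rule exI[of _ "min \<delta> \<delta>'"]) (use \<delta> \<delta>' in auto)
  qed (auto intro: exI[of _ 1])
  then obtain \<delta> where \<delta>: "\<delta> > 0"
      "\<And>u x y. \<lbrakk>u \<in> F; x \<in> X; y \<in> X; d x y < \<delta>\<rbrakk> \<Longrightarrow> d (T u x) (T u y) \<le> \<epsilon>"
    by blast
  have "mtotally_bounded X"
    using compact compact_space_eq_mcomplete_mtotally_bounded by blast
  then obtain K where K: "finite K" "K \<subseteq> X" "X \<subseteq> (\<Union>x\<in>K. mball x (\<delta> / 2))"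
    using \<delta>(1) unfolding mtotally_bounded_def by (meson half_gt_zero)
  obtain S where S: "S \<subseteq> X" "finite S" "card S = Suc (card K)"
    using infinite_arbitrarily_large[OF \<open>infinite X\<close>] by blast
  have "\<exists>q\<in>S \<times> S. fst q \<noteq> snd q \<and>
      (\<forall>u\<in>F. d (T (u \<otimes> p n) (fst q)) (T (u \<otimes> p n) (snd q)) \<le> \<epsilon>)" for n
  proof -
    have "\<exists>k\<in>K. T (p n) x \<in> mball k (\<delta> / 2)" if "x \<in> S" for x
      using K(3) S(1) that T_closed[OF p] by blast
    then obtain c where c: "\<And>x. x \<in> S \<Longrightarrow> c x \<in> K" "\<And>x. x \<in> S \<Longrightarrow> T (p n) x \<in> mball (c x) (\<delta> / 2)"
      by metis
    have "card (c ` S) < card S"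
      using card_mono[OF K(1), of "c ` S"] c(1) S(3) by (simp add: image_subset_iff less_Suc_eq_le)
    then have "\<not> inj_on c S"
      by (rule pigeonhole)
    then obtain x y where xy: "x \<in> S" "y \<in> S" "x \<noteq> y" "c x = c y"
      by (auto simp: inj_on_def)
    have X: "x \<in> X" "y \<in> X" "c y \<in> X"
      using xy S(1) c(1) K(2) by auto
    have "d (T (p n) x) (T (p n) y) < \<delta>"
      using c(2)[OF xy(1)] c(2)[OF xy(2)] xy(4) X
        triangle[of "T (p n) x" "c y" "T (p n) y"] commute[of "T (p n) x" "c y"]
      by simp
    then have "d (T (u \<otimes> p n) x) (T (u \<otimes> p n) y) \<le> \<epsilon>" if "u \<in> F" for u
      using \<delta>(2)[OF that, of "T (p n) x" "T (p n) y"] X T_closed p that assms(3)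
      by (auto simp: composition_rule)
    then show ?thesis
      using xy by (intro bexI[of _ "(x, y)"]) auto
  qed
  then have "\<exists>q\<in>S \<times> S. infinite {n \<in> UNIV. fst q \<noteq> snd q \<and>
      (\<forall>u\<in>F. d (T (u \<otimes> p n) (fst q)) (T (u \<otimes> p n) (snd q)) \<le> \<epsilon>)}"
    by (intro pigeonhole_infinite_rel) (use S in auto)
  then obtain x y where xy: "x \<in> S" "y \<in> S" "infinite {n. x \<noteq> y \<and>
      (\<forall>u\<in>F. d (T (u \<otimes> p n) x) (T (u \<otimes> p n) y) \<le> \<epsilon>)}"
    by auto
  show thesis
    by (rule that[of x y]) (use xy S(1) in \<open>auto split: if_splits\<close>)
qed

end

section \<open>Interplay of horofunctions with the dynamics\<close>

locale metric_group_system =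
  right_invariant_proper_metric G \<rho> + S: topological_dynamical_system G X d T
  for G :: "('a, 'm) monoid_scheme" (structure) and \<rho> and X :: "'x set" and d T
begin

lemma ND_eps_mono:
  assumes "\<epsilon> \<le> \<epsilon>'"
  shows "ND_eps G \<rho> X d T \<epsilon> \<subseteq> ND_eps G \<rho> X d T \<epsilon>'"
  using assms unfolding ND_eps_def by (fastforce intro: order_trans)

text \<open>Otherwise there are horofunctions in \<open>ND_eps\<close> for parameters tending to 0
  that are nonnegative at \<open>g\<close>. A limit of a subsequence is still nonnegative at
  \<open>g\<close>, and as the sets are closed and nested it belongs to all of them, hence to
  \<open>ND\<close>.\<close>

lemma ND_eps_subset_horoball:
  assumes closed: "\<And>\<epsilon>. \<epsilon> > 0 \<Longrightarrow> closedin (border_topology G \<rho>) (ND_eps G \<rho> X d T \<epsilon>)"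
    and g: "g \<in> carrier G" and neg: "\<And>h. h \<in> ND G \<rho> X d T \<Longrightarrow> h g < 0"
  obtains \<epsilon> where "\<epsilon> > 0" "\<And>h. h \<in> ND_eps G \<rho> X d T \<epsilon> \<Longrightarrow> h g < 0"
proof (rule ccontr)
  assume "\<not> thesis"
  then have "\<exists>h. h \<in> ND_eps G \<rho> X d T (inverse (real (Suc n))) \<and> h g \<ge> 0" for n
    using that[of "inverse (real (Suc n))"]
    by (meson inverse_positive_iff_positive not_le of_nat_0_less_iff zero_less_Suc)
  then obtain hs where hs: "\<And>n. hs n \<in> ND_eps G \<rho> X d T (inverse (real (Suc n)))" "\<And>n. hs n g \<ge> 0"
    by metis
  then have border: "hs n \<in> border G \<rho>" for n
    by (auto simp: ND_eps_def)
  then obtain r h where r: "strict_mono (r :: nat \<Rightarrow> nat)" "h \<in> border G \<rho>"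
      "converges_pointwise G (\<lambda>n. hs (r n)) h"
    by (rule border_subsequence)
  have "h \<in> ND_eps G \<rho> X d T \<epsilon>" if "\<epsilon> > 0" for \<epsilon>
  proof (rule closedin_border_limit[OF closed[OF that] _ _ r(2,3)])
    have "\<forall>\<^sub>F n in sequentially. inverse (real (Suc n)) < \<epsilon>"
      using LIMSEQ_inverse_real_of_nat that by (rule order_tendstoD(2))
    then have "\<forall>\<^sub>F n in sequentially. hs n \<in> ND_eps G \<rho> X d T \<epsilon>"
      by eventually_elim (use hs(1) ND_eps_mono in \<open>meson less_imp_le subsetD\<close>)
    then show "\<forall>\<^sub>F n in sequentially. hs (r n) \<in> ND_eps G \<rho> X d T \<epsilon>"
      using eventually_subseq[OF r(1)] by blast
  qed (rule border)
  then have "h g < 0"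
    by (intro neg) (simp add: ND_def)
  moreover have "h g \<ge> 0"
    using r(3) g hs(2) by (intro LIMSEQ_le_const[of "\<lambda>n. hs (r n) g"]) (auto simp: converges_pointwise_def)
  ultimately show False by simp
qed

text \<open>Translating a pair of points by the element where it first fails to be \<open>\<epsilon>\<close>-close turns the
  ball before the failure into \<open>{b\<^bsub>k\<^sup>-\<^sup>1\<^esub> < 0}\<close>, so a limit of such failures
  lies in \<open>ND\<^sub>\<epsilon>\<close>; symmetry of horoballs then transfers the conclusion to \<open>b\<^sub>k\<close>.\<close>

lemma first_failure_descends:
  assumes sym: "symmetric_horoballs_space G \<rho>" and g: "g \<in> carrier G" and "\<epsilon> > 0"
    and neg: "\<And>h. h \<in> ND_eps G \<rho> X d T \<epsilon> \<Longrightarrow> h g < 0"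
  obtains N where "\<And>x y k. \<lbrakk>x \<in> X; y \<in> X; k \<in> carrier G; len k > N; d (T k x) (T k y) > \<epsilon>;
      \<And>u. \<lbrakk>u \<in> carrier G; len u < len k\<rbrakk> \<Longrightarrow> d (T u x) (T u y) \<le> \<epsilon>\<rbrakk>
      \<Longrightarrow> len (k \<otimes> g) < len k"
proof (rule ccontr)
  assume "\<not> thesis"
  then have "\<exists>x y k. x \<in> X \<and> y \<in> X \<and> k \<in> carrier G \<and> len k > real n \<and> d (T k x) (T k y) > \<epsilon> \<and>
      (\<forall>u\<in>carrier G. len u < len k \<longrightarrow> d (T u x) (T u y) \<le> \<epsilon>) \<and> len (k \<otimes> g) \<ge> len k" for n
    using that[of "real n"] by (meson not_le)
  then obtain x y k where xyk: "\<And>n. x n \<in> X" "\<And>n. y n \<in> X" "\<And>n. k n \<in> carrier G"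
      "\<And>n. len (k n) > real n" "\<And>n. d (T (k n) (x n)) (T (k n) (y n)) > \<epsilon>"
      "\<And>n u. \<lbrakk>u \<in> carrier G; len u < len (k n)\<rbrakk> \<Longrightarrow> d (T u (x n)) (T u (y n)) \<le> \<epsilon>"
      "\<And>n. len (k n \<otimes> g) \<ge> len (k n)"
    by metis
  have k_inf: "goes_to_infinity G k"
    unfolding goes_to_infinity_iff_len
    using xyk(3) less_imp_le[OF xyk(4)]
    by (auto intro: filterlim_at_top_mono[OF filterlim_real_sequentially])
  define a where "a n = T (k n) (x n)" for n
  define b where "b n = T (k n) (y n)" for n
  have ab: "a n \<in> X" "b n \<in> X" for n
    using S.T_closed xyk by (auto simp: a_def b_def)
  obtain r1 x' y' where r1: "strict_mono (r1 :: nat \<Rightarrow> nat)" "x' \<in> X" "y' \<in> X"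
      "limitin S.mtopology (a \<circ> r1) x' sequentially" "limitin S.mtopology (b \<circ> r1) y' sequentially"
    by (rule S.pair_subsequence[of a b]) (use ab in auto)
  \<comment> \<open>Successive extractions: \<open>r1\<close> makes the translated pairs converge,
    \<open>r2\<close> the functions of the inverses of \<open>k\<close>, and \<open>r3\<close> those
    of \<open>k\<close> itself.\<close>
  obtain r2 h where r2: "strict_mono r2" "h \<in> border G \<rho>"
      "converges_pointwise G (\<lambda>n. busemann G \<rho> (inv k (r1 (r2 n)))) h"
    by (rule busemann_subsequence[OF goes_to_infinity_inv[OF goes_to_infinity_subseq[OF k_inf r1(1)]]])
  define r where "r = r1 \<circ> r2"
  have r: "strict_mono r"
    unfolding r_def by (rule strict_mono_o[OF r1(1) r2(1)])
  obtain r3 h' where r3: "strict_mono r3" "h' \<in> border G \<rho>"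
      "converges_pointwise G (\<lambda>n. busemann G \<rho> (k (r (r3 n)))) h'"
    by (rule busemann_subsequence[OF goes_to_infinity_subseq[OF k_inf r]])
  have ran: "range (a \<circ> r) \<subseteq> X" "range (b \<circ> r) \<subseteq> X"
    using ab by auto
  have lims: "limitin S.mtopology (a \<circ> r) x' sequentially" "limitin S.mtopology (b \<circ> r) y' sequentially"
    unfolding r_def o_assoc by (rule limitin_subsequence[OF r2(1)], fact)+
  have "\<epsilon> \<le> d x' y'"
    by (rule LIMSEQ_le_const[OF S.tendsto_dist[OF ran lims]])
      (use xyk(5) in \<open>auto simp: a_def b_def intro: less_imp_le\<close>)
  with \<open>\<epsilon> > 0\<close> r1(2) have "x' \<noteq> y'" by auto
  moreover have "d (T f x') (T f y') \<le> \<epsilon>" if "f \<in> horoball G h" for f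
  proof (rule LIMSEQ_le_const2)
    have f: "f \<in> carrier G" "h f < 0"
      using that by (auto simp: horoball_def)
    show "(\<lambda>n. d (T f ((a \<circ> r) n)) (T f ((b \<circ> r) n))) \<longlonglongrightarrow> d (T f x') (T f y')"
      by (rule S.tendsto_dist_T[OF f(1) ran lims])
    have "\<forall>\<^sub>F n in sequentially. busemann G \<rho> (inv k (r1 (r2 n))) f < 0"
      using r2(3) f by (auto simp: converges_pointwise_def intro: order_tendstoD(2))
    then have "\<forall>\<^sub>F n in sequentially. d (T f ((a \<circ> r) n)) (T f ((b \<circ> r) n)) \<le> \<epsilon>"
    proof eventually_elim
      case (elim n)
      \<comment> \<open>As inversion preserves length, \<open>b_(k^-1)\<close> at \<open>f\<close>
        equals \<open>|f k| - |k|\<close>. Where it is negative, \<open>f k\<close> comes before the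
        first failure.\<close>
      have "len (f \<otimes> k (r n)) < len (k (r n))"
        using elim f xyk(3) len_inv[of "f \<otimes> k (r n)"]
        by (simp add: r_def busemann_eq_len len_inv inv_mult_group)
      then show ?case
        using xyk(6)[of "f \<otimes> k (r n)" "r n"] f(1) xyk(1-3)
        by (simp add: a_def b_def S.composition_rule)
    qed
    then show "\<exists>M. \<forall>n\<ge>M. d (T f ((a \<circ> r) n)) (T f ((b \<circ> r) n)) \<le> \<epsilon>"
      by (simp add: eventually_sequentially)
  qed
  ultimately have "h \<in> ND_eps G \<rho> X d T \<epsilon>"
    using r1(2,3) r2(2) by (auto simp: ND_eps_def)
  then have "h g < 0"
    by (rule neg)
  have inf: "goes_to_infinity G (\<lambda>n. inv k (r (r3 n)))"
    using goes_to_infinity_inv[OF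
        goes_to_infinity_subseq[OF goes_to_infinity_subseq[OF k_inf r] r3(1)]] .
  have lim_h: "converges_pointwise G (\<lambda>n. busemann G \<rho> (inv k (r (r3 n)))) h"
    using r2(3) LIMSEQ_subseq_LIMSEQ[OF _ r3(1)]
    by (fastforce simp: converges_pointwise_def r_def o_def)
  have lim_h': "converges_pointwise G (\<lambda>n. busemann G \<rho> (inv (inv k (r (r3 n))))) h'"
    using r3(3) xyk(3) by simp
  \<comment> \<open>Symmetry is applied to the sequence of inverses, whose own inverses are the
    elements \<open>k\<close>.\<close>
  have "{u \<in> carrier G. h (inv u) < 0} = {u \<in> carrier G. h' u < 0}"
    by (rule sym[unfolded symmetric_horoballs_space_def, rule_format,
        of "\<lambda>n. inv k (r (r3 n))" h h']) (intro conjI inf lim_h lim_h')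
  moreover have "inv g \<in> {u \<in> carrier G. h (inv u) < 0}"
    using \<open>h g < 0\<close> g by simp
  ultimately have "h' (inv g) < 0"
    by blast
  \<comment> \<open>This value is \<open>|k g| - |k|\<close>, nonnegative by the choice of the
    counterexamples \<open>k\<close>.\<close>
  moreover have "busemann G \<rho> (k (r (r3 n))) (inv g) \<ge> 0" for n
    using xyk(3,7) g by (simp add: busemann_eq_len)
  then have "h' (inv g) \<ge> 0"
    using r3(3) g
    by (intro LIMSEQ_le_const[of "\<lambda>n. busemann G \<rho> (k (r (r3 n))) (inv g)"])
      (auto simp: converges_pointwise_def)
  ultimately show False by simp
qed

lemma horoballs_inter_torsion:
  assumes sym: "symmetric_horoballs_space G \<rho>" and "infinite X"
    and closed: "\<And>\<epsilon>. \<epsilon> > 0 \<Longrightarrow> closedin (border_topology G \<rho>) (ND_eps G \<rho> X d T \<epsilon>)"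
    and g: "g \<in> carrier G" and neg: "\<And>h. h \<in> ND G \<rho> X d T \<Longrightarrow> h g < 0"
  shows "g \<in> Tor G"
proof (rule ccontr)
  assume nt: "g \<notin> Tor G"
  obtain \<epsilon> where \<epsilon>: "\<epsilon> > 0" "\<And>h. h \<in> ND_eps G \<rho> X d T \<epsilon> \<Longrightarrow> h g < 0"
    using ND_eps_subset_horoball[of g] closed g neg by blast
  obtain N where N: "\<And>x y k. \<lbrakk>x \<in> X; y \<in> X; k \<in> carrier G; len k > N; d (T k x) (T k y) > \<epsilon>;
      \<And>u. \<lbrakk>u \<in> carrier G; len u < len k\<rbrakk> \<Longrightarrow> d (T u x) (T u y) \<le> \<epsilon>\<rbrakk>
      \<Longrightarrow> len (k \<otimes> g) < len k"
    using first_failure_descends[of g \<epsilon>] sym g \<epsilon> by blast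
  have len_g: "len g \<ge> 0"
    by (simp add: len_def)
  define p where "p n = inv g [^] (n::nat)" for n
  have p: "p n \<in> carrier G" for n
    using g by (simp add: p_def)
  \<comment> \<open>Hence right multiplication by \<open>g\<close> carries failures of the
    \<open>n\<close>-th translated pair to failures of the next one.\<close>
  have p_Suc: "(k \<otimes> g) \<otimes> p (Suc n) = k \<otimes> p n" if "k \<in> carrier G" for k n
  proof -
    have "p (Suc n) = inv g \<otimes> p n"
      using g nat_pow_Suc2 by (simp add: p_def del: nat_pow_Suc)
    moreover have "g \<otimes> (inv g \<otimes> p n) = p n"
      using g p by (simp flip: m_assoc)
    ultimately show ?thesis
      using that g p by (simp add: m_assoc)
  qed
  \<comment> \<open>The margin \<open>len g\<close> beyond \<open>N\<close> pays for the growth that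
    one multiplication by \<open>g\<close> can cause.\<close>
  define F where "F = {u \<in> carrier G. len u \<le> N + len g}"
  obtain x y where xy: "x \<in> X" "y \<in> X" "x \<noteq> y"
      "infinite {n. \<forall>u\<in>F. d (T (u \<otimes> p n) x) (T (u \<otimes> p n) y) \<le> \<epsilon>}"
    by (rule S.infinitely_often_close_pair[OF \<open>infinite X\<close> _ _ \<epsilon>(1), of F p])
      (use finite_len_le p in \<open>auto simp: F_def\<close>)
  define D where "D n = {k \<in> carrier G. d (T (k \<otimes> p n) x) (T (k \<otimes> p n) y) > \<epsilon>}" for n
  \<comment> \<open>A pair that never fails would put the whole border into \<open>ND_eps\<close>,
    including a horofunction nonnegative at \<open>g\<close>, which exists because \<open>g\<close>
    has infinite order.\<close>
  have "\<exists>f\<in>carrier G. d (T f x) (T f y) > \<epsilon>"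
  proof (rule ccontr)
    assume "\<not> ?thesis"
    then have "border G \<rho> \<subseteq> ND_eps G \<rho> X d T \<epsilon>"
      using xy(1-3) unfolding ND_eps_def horoball_def by (fastforce simp: not_less)
    moreover obtain h where "h \<in> border G \<rho>" "h g \<ge> 0"
      using infinite_order_nonneg_horofunction[OF g nt] .
    ultimately show False
      using \<epsilon>(2)[of h] by auto
  qed
  then obtain f where f: "f \<in> carrier G" "d (T f x) (T f y) > \<epsilon>"
    by blast
  \<comment> \<open>\<open>D n\<close> contains \<open>f p(n)^-1\<close>, and only finitely many of
    its elements are at most as long, so a shortest failure exists.\<close>
  have "\<exists>k\<in>D n. \<forall>u\<in>D n. len k \<le> len u" for n
  proof -
    let ?e = "f \<otimes> inv (p n)"
    let ?A = "{u \<in> D n. len u \<le> len ?e}"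
    have e: "?e \<in> ?A"
      using f p by (simp add: D_def m_assoc)
    have "finite ?A"
      by (rule finite_subset[OF _ finite_len_le[of "len ?e"]]) (auto simp: D_def)
    then obtain k where "k \<in> ?A" "\<forall>u\<in>?A. len k \<le> len u"
      using e arg_min_if_finite(1)[of ?A len] arg_min_least[of ?A _ len] by blast
    then show ?thesis
      by (intro bexI[of _ k]) force+
  qed
  then obtain K where K: "\<And>n. K n \<in> D n" "\<And>n u. u \<in> D n \<Longrightarrow> len (K n) \<le> len u"
    by metis
  have KG: "K n \<in> carrier G" for n
    using K(1)[of n] by (simp add: D_def)
  have descends: "len (K n \<otimes> g) < len (K n)" if "len (K n) > N" for n
  proof (rule N[of "T (p n) x" "T (p n) y"])
    show "d (T u (T (p n) x)) (T u (T (p n) y)) \<le> \<epsilon>" if "u \<in> carrier G" "len u < len (K n)" for u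
      using K(2)[of u n] that xy p by (force simp: D_def S.composition_rule)
  qed (use K(1)[of n] that xy p S.T_closed in \<open>auto simp: D_def S.composition_rule\<close>)
  have K_Suc: "K n \<otimes> g \<in> D (Suc n)" for n
    using K(1)[of n] g by (simp add: D_def p_Suc)
  have dec: "len (K (Suc n)) < len (K n)" if "len (K n) > N" for n
    using K(2)[OF K_Suc[of n]] descends[OF that] by simp
  \<comment> \<open>Largeness propagates to smaller indices: \<open>K n\<close> must be longer than
    \<open>N\<close>, so the descent applies and makes it even longer than
    \<open>K (Suc n)\<close>.\<close>
  have up: "len (K n) > N + len g" if "len (K (Suc n)) > N + len g" for n
  proof -
    have "len (K (Suc n)) \<le> len (K n) + len g"
      using K(2)[OF K_Suc[of n]] len_mult_le[OF KG[of n] g] by linarith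
    with that dec[of n] show ?thesis by linarith
  qed
  have large: "len (K n) > N + len g" for n
  proof -
    \<comment> \<open>Closeness on \<open>F\<close> forces the first failure \<open>K m\<close> out
      of \<open>F\<close>; from this \<open>m\<close> the bound is carried down to \<open>n\<close>
      by \<open>up\<close>.\<close>
    obtain m where "m \<ge> n" "\<forall>u\<in>F. d (T (u \<otimes> p m) x) (T (u \<otimes> p m) y) \<le> \<epsilon>"
      using xy(4) unfolding infinite_nat_iff_unbounded_le by auto
    then have "len (K m) > N + len g"
      using K(1)[of m] by (force simp: D_def F_def)
    with \<open>m \<ge> n\<close> show ?thesis
      by (induction m rule: dec_induct) (auto intro: up)
  qed
  have "len (K (Suc n)) < len (K n)" for n
    using dec[of n] large[of n] len_g by simp
  then show False
    using len_not_eventually_decreasing[of K 0] KG by (meson not_le)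
qed

end

theorem theorem2:
  fixes G :: "('a, 'm) monoid_scheme"
    and \<rho> :: "'a \<Rightarrow> 'a \<Rightarrow> real"
    and X :: "'x set"
    and d :: "'x \<Rightarrow> 'x \<Rightarrow> real"
    and T :: "'a \<Rightarrow> 'x \<Rightarrow> 'x"
  assumes "group G"
    and "infinite (carrier G)"
    and "countable (carrier G)"
    and "right_invariant_proper_metric G \<rho>"
    and "symmetric_horoballs_space G \<rho>"
    and "topological_dynamical_system G X d T"
    and "infinite X"
    and "\<And>\<epsilon>. \<epsilon> > 0 \<Longrightarrow> closedin (border_topology G \<rho>) (ND_eps G \<rho> X d T \<epsilon>)"
  shows "carrier G \<inter> (\<Inter>h\<in>ND G \<rho> X d T. horoball G h) \<subseteq> Tor G
    \<and> (torsion_free G \<longrightarrow> carrier G \<inter> (\<Inter>h\<in>ND G \<rho> X d T. horoball G h) = {})"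
proof -
  interpret metric_group_system G \<rho> X d T
    using assms(4,6) by (rule metric_group_system.intro)
  have sub: "carrier G \<inter> (\<Inter>h\<in>ND G \<rho> X d T. horoball G h) \<subseteq> Tor G"
  proof
    fix g assume "g \<in> carrier G \<inter> (\<Inter>h\<in>ND G \<rho> X d T. horoball G h)"
    then show "g \<in> Tor G"
      using assms(5,7,8) by (intro horoballs_inter_torsion) (auto simp: horoball_def)
  qed
  moreover have "carrier G \<inter> (\<Inter>h\<in>ND G \<rho> X d T. horoball G h) = {}" if "torsion_free G"
  proof -
    have Tor: "Tor G = {\<one>\<^bsub>G\<^esub>}"
      using that by (simp add: torsion_free_def)
    \<comment> \<open>If \<open>ND\<close> were empty, the intersection would be the whole infinite
      carrier, which does not fit into the trivial torsion set.\<close>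
    obtain h where h: "h \<in> ND G \<rho> X d T"
      using sub Tor assms(2) finite_subset[of "carrier G" "{\<one>\<^bsub>G\<^esub>}"] by auto
    then have "h \<in> ND_eps G \<rho> X d T 1"
      by (simp add: ND_def)
    \<comment> \<open>Horofunctions vanish at the identity, so this only possible torsion element
      lies in no horoball.\<close>
    then have "\<bar>h \<one>\<^bsub>G\<^esub>\<bar> \<le> len \<one>\<^bsub>G\<^esub>"
      by (intro border_abs_le) (simp_all add: ND_eps_def)
    then have "\<one>\<^bsub>G\<^esub> \<notin> horoball G h"
      by (simp add: horoball_def len_def)
    with sub Tor h show ?thesis by blast
  qed
  ultimately show ?thesis by blast
qed

end
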